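(* Let $\mu,\nu$ be countably supported $q$-tame measures on $\{(x,y)\in\mathbb{R}^2 : x<y\}$ such that $W_1^{\mathrm{rank}}(\mu,0)$ and $W_1^{\mathrm{rank}}(\nu,0)$ are finite, where $0$ denotes the zero measure. Then $$\Vert \Lambda\mu-\Lambda\nu\Vert_1\le\tfrac12\,W_1^{\mathrm{rank}}(\mu,\nu),$$ where $\Lambda\mu,\Lambda\nu:(0,\infty)\times\mathbb{R}\to[0,\infty)$ are the continuous persistence landscapes of $\mu,\nu$ and $\Vert\cdot\Vert_1$ is the $L^1$-norm on $(0,\infty)\times\mathbb{R}$ with respect to Lebesgue measure.
   Context: Let $\mathbb{R}^2_<=\{(x,y)\in\mathbb{R}^2 : x<y\}$ and $\mathbb{R}^2_\le=\{(x,y)\in\mathbb{R}^2 : x\le y\}$, with their subspace topologies. For $t\in\mathbb{R}$ and $h\ge0$ let $Q_{t,h}=(-\infty,t-h)\times(t+h,\infty)\subset\mathbb{R}^2_<$. A (nonnegative) Borel measure $\mu$ on $\mathbb{R}^2_<$ is $q$-tame if $\mu(Q_{t,h})<\infty$ for all $t\in\mathbb{R}$, $h\ge0$. It is countably supported if it is a countable sum of nonnegative real multiples of Dirac measures at points of $\mathbb{R}^2_<$. The continuous persistence landscape of a $q$-tame measure $\mu$ is $\Lambda\mu(a,t)=\sup\{h>0 : \mu(Q_{t,h})\ge a\}$ for $a>0$, $t\in\mathbb{R}$, where $\sup\emptyset=0$. For $x=(x_1,x_2),\,y=(y_1,y_2)\in\mathbb{R}^2_\le$ define $$d_{\mathrm{rank}}(x,y)=\tfrac12(x_2-x_1)^2+\tfrac12(y_2-y_1)^2-\max\bigl(\min(x_2,y_2)-\max(x_1,y_1),0\bigr)^2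 .$$ (It is a pseudometric on $\mathbb{R}^2_\le$, inducing a metric after collapsing the diagonal to a point.) A coupling of two measures $\mu,\nu$ on $\mathbb{R}^2_<$ is a Borel measure $\gamma$ on $\mathbb{R}^2_\le\times\mathbb{R}^2_\le$ whose pushforwards under the first and second projections to $\mathbb{R}^2_\le$, restricted to $\mathbb{R}^2_<$, equal $\mu$ and $\nu$ respectively (no condition is imposed on the diagonal). Then $$W_1^{\mathrm{rank}}(\mu,\nu)=\inf_\gamma\int d_{\mathrm{rank}}(x,y)\,d\gamma(x,y),$$ the infimum being over all couplings $\gamma$ of $\mu$ and $\nu$. *)

theory Defs
  imports "HOL-Probability.Probability"
begin

definition above_diag :: "(real \<times> real) set" where
  "above_diag = {(x, y). x < y}"

definition weakly_above_diag :: "(real \<times> real) set" where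
  "weakly_above_diag = {(x, y). x \<le> y}"

abbreviation borel_on :: "'a::topological_space set \<Rightarrow> 'a measure" where
  "borel_on S \<equiv> restrict_space borel S"

definition quadrant :: "real \<Rightarrow> real \<Rightarrow> (real \<times> real) set" where
  "quadrant t h = {..<t - h} \<times> {t + h<..}"

definition q_tame :: "(real \<times> real) measure \<Rightarrow> bool" where
  "q_tame \<mu> \<longleftrightarrow> sets \<mu> = sets (borel_on above_diag) \<and>
     (\<forall>t. \<forall>h\<ge>0. emeasure \<mu> (quadrant t h) < \<infinity>)"

text \<open>Finite sums of Dirac measures are included, since coefficients may vanish.\<close>

definition countably_supported :: "(real \<times> real) measure \<Rightarrow> bool" where
  "countably_supported \<mu> \<longleftrightarrow> sets \<mu> = sets (borel_on above_diag) \<and>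
     (\<exists>(c :: nat \<Rightarrow> real) (p :: nat \<Rightarrow> real \<times> real).
        (\<forall>n. 0 \<le> c n) \<and> (\<forall>n. p n \<in> above_diag) \<and>
        (\<forall>A\<in>sets (borel_on above_diag).
           emeasure \<mu> A = (\<Sum>n. ennreal (c n) * emeasure (return (borel_on above_diag) (p n)) A)))"

text \<open>For q-tame \<open>\<mu>\<close> and \<open>a > 0\<close> the set below is bounded above, since the quadrants
  decrease to the empty set as \<open>h\<close> grows; so the real-valued supremum is the true one.\<close>

definition landscape :: "(real \<times> real) measure \<Rightarrow> real \<Rightarrow> real \<Rightarrow> real" where
  "landscape \<mu> a t =
     (let H = {h. h > 0 \<and> emeasure \<mu> (quadrant t h) \<ge> ennreal a} in if H = {} then 0 else Sup H)"

definition d_rank :: "real \<times> real \<Rightarrow> real \<times> real \<Rightarrow> real" where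
  "d_rank x y = (snd x - fst x)\<^sup>2 / 2 + (snd y - fst y)\<^sup>2 / 2
     - (max (min (snd x) (snd y) - max (fst x) (fst y)) 0)\<^sup>2"

definition couplings ::
    "(real \<times> real) measure \<Rightarrow> (real \<times> real) measure \<Rightarrow> ((real \<times> real) \<times> (real \<times> real)) measure set" where
  "couplings \<mu> \<nu> = {\<gamma>. sets \<gamma> = sets (borel_on (weakly_above_diag \<times> weakly_above_diag)) \<and>
     restrict_space (distr \<gamma> (borel_on weakly_above_diag) fst) above_diag = \<mu> \<and>
     restrict_space (distr \<gamma> (borel_on weakly_above_diag) snd) above_diag = \<nu>}"

definition W1_rank :: "(real \<times> real) measure \<Rightarrow> (real \<times> real) measure \<Rightarrow> ennreal" where
  "W1_rank \<mu> \<nu> = (INF \<gamma>\<in>couplings \<mu> \<nu>. \<integral>\<^sup>+ (x, y). ennreal (d_rank x y) \<partial>\<gamma>)"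

definition L1_norm_on :: "'a::euclidean_space set \<Rightarrow> ('a \<Rightarrow> real) \<Rightarrow> ennreal" where
  "L1_norm_on S f = (\<integral>\<^sup>+ p\<in>S. ennreal \<bar>f p\<bar> \<partial>lborel)"

end

theory Submission
  imports Defs
begin

text \<open>
  For fixed \<open>t\<close>, the functions \<open>h \<mapsto> \<mu> (quadrant t h)\<close> and \<open>a \<mapsto> landscape \<mu> a t\<close> are generalised
  inverses of each other, so by the layer cake principle the \<open>L\<^sup>1\<close> distance of the landscapes is at most
  that of the rank functions \<open>(t, h) \<mapsto> \<mu> (quadrant t h)\<close>. Given a coupling \<open>\<gamma>\<close>, the rank functions at
  \<open>(t, h)\<close> differ by at most the \<open>\<gamma>\<close>-measure of the pairs \<open>(x, y)\<close> with exactly one entry in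
  \<open>quadrant t h\<close>. By Tonelli it remains to compute, for given \<open>(x, y)\<close>, the area of the set of such
  \<open>(t, h)\<close>: it is the symmetric difference of two triangles, and its area is \<open>d_rank x y / 2\<close>.
\<close>

section \<open>Elementary facts on quadrants and Borel sets\<close>

lemma quadrant_antimono: "h \<le> h' \<Longrightarrow> quadrant t h' \<subseteq> quadrant t h"
  by (auto simp: quadrant_def)

lemma quadrant_subset_above_diag: "0 \<le> h \<Longrightarrow> quadrant t h \<subseteq> above_diag"
  by (auto simp: quadrant_def above_diag_def)

lemma above_diag_borel [measurable]: "above_diag \<in> sets borel"
proof -
  have "above_diag = {p. fst p < snd p}"
    by (auto simp: above_diag_def)
  also have "\<dots> \<in> sets borel"
    by (intro borel_open open_Collect_less continuous_intros)
  finally show ?thesis .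
qed

lemma weakly_above_diag_borel [measurable]: "weakly_above_diag \<in> sets borel"
proof -
  have "weakly_above_diag = {p. fst p \<le> snd p}"
    by (auto simp: weakly_above_diag_def)
  also have "\<dots> \<in> sets borel"
    by (intro borel_closed closed_Collect_le continuous_intros)
  finally show ?thesis .
qed

lemma above_diag_subset: "above_diag \<subseteq> weakly_above_diag"
  by (auto simp: above_diag_def weakly_above_diag_def)

lemma quadrant_borel [measurable]: "quadrant t h \<in> sets borel"
  unfolding quadrant_def by (intro borel_open open_Times) auto

lemma sets_quadrant:
  assumes "sets \<mu> = sets (borel_on above_diag)" and "0 \<le> h"
  shows "quadrant t h \<in> sets \<mu>"
  using assms quadrant_subset_above_diag by (simp add: sets_restrict_space_iff)

section \<open>Landscapes as generalised inverses of rank functions\<close>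

lemma q_tame_rank_mono:
  assumes "q_tame \<mu>" and "0 \<le> h" and "h \<le> h'"
  shows "emeasure \<mu> (quadrant t h') \<le> emeasure \<mu> (quadrant t h)"
  using assms by (intro emeasure_mono quadrant_antimono sets_quadrant) (auto simp: q_tame_def)

text \<open>Otherwise monotonicity in \<open>h\<close> would give every \<open>quadrant t n\<close>
  mass at least \<open>a\<close>. These quadrants have finite mass and decrease to the empty set,
  contradicting continuity from above. Boundedness makes the real \<open>Sup\<close> in
  \<open>landscape\<close> a genuine supremum.\<close>

lemma bdd_above_landscape_set:
  assumes "q_tame \<mu>" and "0 < a"
  shows "bdd_above {h. h > 0 \<and> emeasure \<mu> (quadrant t h) \<ge> ennreal a}"
proof (rule ccontr)
  assume "\<not> ?thesis"
  then have unb: "\<exists>h>x. h > 0 \<and> emeasure \<mu> (quadrant t h) \<ge> ennreal a" for x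
    unfolding bdd_above_def by (auto simp: not_le)
  have large: "ennreal a \<le> emeasure \<mu> (quadrant t (real n))" for n
  proof -
    obtain h where "h > real n" "ennreal a \<le> emeasure \<mu> (quadrant t h)"
      using unb by blast
    with q_tame_rank_mono[OF assms(1), of "real n" h t] show ?thesis
      by auto
  qed
  have "(INF n. emeasure \<mu> (quadrant t (real n))) = emeasure \<mu> (\<Inter>n. quadrant t (real n))"
    using assms
    by (intro INF_emeasure_decseq)
       (auto simp: q_tame_def less_top[symmetric] intro!: sets_quadrant decseq_SucI quadrant_antimono)
  also have "(\<Inter>n. quadrant t (real n)) = {}"
  proof -
    have False if "\<And>n. (x, y) \<in> quadrant t (real n)" for x y
    proof -
      obtain n where "t - x < real n"
        using reals_Archimedean2 by blast
      with that[of n] show False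
        by (simp add: quadrant_def)
    qed
    then show ?thesis
      by fastforce
  qed
  finally have "ennreal a \<le> 0"
    using large by (metis INF_greatest emeasure_empty)
  with assms show False
    by simp
qed

lemma landscape_nonneg: "q_tame \<mu> \<Longrightarrow> 0 < a \<Longrightarrow> 0 \<le> landscape \<mu> a t"
  unfolding landscape_def Let_def
  using bdd_above_landscape_set[of \<mu> a t] by (auto intro: cSup_upper2)

text \<open>Together with the next lemma, this is the inverse relation between rank function and
  landscape. Both leave open the level \<open>h = landscape \<mu> a t\<close>, where the supremum
  may or may not be attained; a single level is Lebesgue-null.\<close>

lemma rank_ge_if_less_landscape:
  assumes "q_tame \<mu>" and "0 < h" and "h < landscape \<mu> a t"
  shows "ennreal a \<le> emeasure \<mu> (quadrant t h)"
proof -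
  let ?H = "{h. h > 0 \<and> emeasure \<mu> (quadrant t h) \<ge> ennreal a}"
  have "?H \<noteq> {}" "h < Sup ?H"
    using assms by (auto simp: landscape_def Let_def split: if_splits)
  then obtain h' where "h' \<in> ?H" "h < h'"
    by (meson less_cSupE)
  with q_tame_rank_mono[OF assms(1), of h h' t] assms show ?thesis
    by auto
qed

lemma rank_less_if_landscape_less:
  assumes "q_tame \<mu>" and "0 < a" and "landscape \<mu> a t < h"
  shows "emeasure \<mu> (quadrant t h) < ennreal a"
proof (rule ccontr)
  assume "\<not> ?thesis"
  moreover have "0 < h"
    using assms landscape_nonneg by (meson le_less_trans)
  ultimately have *: "h \<in> {h. h > 0 \<and> emeasure \<mu> (quadrant t h) \<ge> ennreal a}"
    by (simp add: not_less)
  then have "h \<le> landscape \<mu> a t"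
    unfolding landscape_def Let_def
    using bdd_above_landscape_set[OF assms(1,2), of t] by (auto intro: cSup_upper)
  with assms show False
    by simp
qed

text \<open>At every height strictly between the two landscape values, exactly one of the measures
  still has mass at least \<open>a\<close>. The bound is an integral rather than an
  \<open>emeasure\<close> because monotonicity of \<open>nn_integral\<close> requires no
  measurability of the set.\<close>

lemma landscape_diff_le:
  assumes \<mu>: "q_tame \<mu>" and \<nu>: "q_tame \<nu>" and a: "0 < a"
  shows "ennreal \<bar>landscape \<mu> a t - landscape \<nu> a t\<bar> \<le>
    (\<integral>\<^sup>+h. indicator {h. 0 < h \<and> (ennreal a \<le> emeasure \<mu> (quadrant t h)) \<noteq>
                              (ennreal a \<le> emeasure \<nu> (quadrant t h))} h \<partial>lborel)"
  (is "_ \<le> (\<integral>\<^sup>+h. indicator ?D h \<partial>lborel)")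
proof -
  let ?l = "min (landscape \<mu> a t) (landscape \<nu> a t)"
  let ?u = "max (landscape \<mu> a t) (landscape \<nu> a t)"
  have "0 \<le> ?l"
    using landscape_nonneg \<mu> \<nu> a by simp
  then have "{?l<..<?u} \<subseteq> ?D"
    using rank_ge_if_less_landscape[OF \<mu>] rank_ge_if_less_landscape[OF \<nu>]
      rank_less_if_landscape_less[OF \<mu> a] rank_less_if_landscape_less[OF \<nu> a]
    by (fastforce simp: min_def max_def not_le[symmetric] split: if_splits)
  have "ennreal \<bar>landscape \<mu> a t - landscape \<nu> a t\<bar> = emeasure lborel {?l<..<?u}"
    by (auto simp: min_def max_def abs_if)
  also have "\<dots> = (\<integral>\<^sup>+h. indicator {?l<..<?u} h \<partial>lborel)"
    by simp
  also have "\<dots> \<le> (\<integral>\<^sup>+h. indicator ?D h \<partial>lborel)"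
    using \<open>{?l<..<?u} \<subseteq> ?D\<close> by (intro nn_integral_mono) (auto split: split_indicator)
  finally show ?thesis .
qed

section \<open>Tents and the area of their symmetric differences\<close>

text \<open>For \<open>x = (b, d)\<close> with b < d this is the open triangle in the (t, h)-plane
  with base from b to d on the axis h = 0 and apex ((b + d)/2, (d - b)/2); otherwise it is empty. It
  swaps the roles of point and quadrant, in preparation for Tonelli.\<close>

definition tent :: "real \<times> real \<Rightarrow> (real \<times> real) set" where
  "tent x = {(t, h). 0 < h \<and> x \<in> quadrant t h}"

lemma tent_borel [simp, measurable]: "tent x \<in> sets borel"
proof -
  have "tent x = {p. 0 < snd p \<and> fst x < fst p - snd p \<and> fst p + snd p < snd x}"
    by (auto simp: tent_def quadrant_def mem_Times_iff)
  also have "\<dots> \<in> sets borel"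
    by (intro borel_open open_Collect_conj open_Collect_less continuous_intros)
  finally show ?thesis .
qed

lemma emeasure_tent: "emeasure lborel (tent (x, y)) = ennreal ((max (y - x) 0)\<^sup>2 / 4)"
proof (cases "x < y")
  case False
  then have "tent (x, y) = {}"
    by (auto simp: tent_def quadrant_def)
  with False show ?thesis
    by simp
next
  case True
  have "emeasure lborel (tent (x, y)) = (\<integral>\<^sup>+h. emeasure lborel ((\<lambda>t. (t, h)) -` tent (x, y)) \<partial>lborel)"
    by (subst lborel_prod[symmetric], rule lborel_pair.emeasure_pair_measure_alt2)
       (simp only: lborel_prod sets_lborel tent_borel)
  also have "\<dots> = (\<integral>\<^sup>+h. ennreal (y - x - 2 * h) * indicator {0..(y - x) / 2} h \<partial>lborel)"
  \<comment> \<open>At h = 0 the slice is empty while the right-hand side equals y - x, so the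
    integrands agree only off this null set.\<close>
  proof (intro nn_integral_cong_AE AE_I[where N = "{0}"])
    have "(\<lambda>t. (t, h)) -` tent (x, y) = (if 0 < h then {x + h<..<y - h} else {})" for h
      by (auto simp: tent_def quadrant_def)
    moreover have "emeasure lborel {c<..<d} = ennreal (d - c)" for c d :: real
      by (cases "c \<le> d") (auto simp: ennreal_neg)
    ultimately show "{h \<in> space lborel. emeasure lborel ((\<lambda>t. (t, h)) -` tent (x, y)) \<noteq>
        ennreal (y - x - 2 * h) * indicator {0..(y - x) / 2} h} \<subseteq> {0}"
      by (auto simp: algebra_simps ennreal_eq_0_iff split: split_indicator if_splits)
  qed auto
  \<comment> \<open>The antiderivative is (y - x) h - h^2, taken between 0 and (y - x)/2.\<close>
  also have "\<dots> = ennreal (((y - x) * ((y - x) / 2) - ((y - x) / 2)\<^sup>2) - ((y - x) * 0 - 0\<^sup>2))"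
    using True by (intro nn_integral_FTC_Icc) (auto intro!: derivative_eq_intros)
  also have "\<dots> = ennreal ((max (y - x) 0)\<^sup>2 / 4)"
    using True by (intro arg_cong[of _ _ ennreal]) (simp add: power2_eq_square field_simps)
  finally show ?thesis .
qed

text \<open>Lower bounds combine by \<open>max\<close>, upper bounds by \<open>min\<close>. The
  resulting pair may lie on or below the diagonal; its tent is then empty, which is the outer
  \<open>max\<close> with 0 in \<open>d_rank\<close>.\<close>

lemma tent_Int: "tent x \<inter> tent y = tent (max (fst x) (fst y), min (snd x) (snd y))"
  by (auto simp: tent_def quadrant_def mem_Times_iff)

text \<open>Inclusion-exclusion: the two areas minus twice the area of the intersection. Each area
  is a quarter of a squared length, and the intersection is again a tent, so the three terms are
  half of those in \<open>d_rank\<close>.\<close>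

lemma emeasure_tent_sym_diff:
  assumes "x \<in> weakly_above_diag" and "y \<in> weakly_above_diag"
  shows "emeasure lborel (sym_diff (tent x) (tent y)) = ennreal (d_rank x y) / 2"
proof -
  have fm: "tent z \<in> fmeasurable lborel" for z
    by (cases z) (auto intro!: fmeasurableI simp: emeasure_tent)
  have m: "measure lborel (tent z) = (max (snd z - fst z) 0)\<^sup>2 / 4" for z
    by (cases z) (auto simp: measure_def emeasure_tent)
  have diff: "measure lborel (tent u - tent v) = measure lborel (tent u) - measure lborel (tent u \<inter> tent v)" for u v
    using measurable_measure_Diff[OF fm[of u], of "tent u \<inter> tent v"]
    by (simp add: Diff_Int)
  have "measure lborel (sym_diff (tent x) (tent y)) =
      measure lborel (tent x - tent y) + measure lborel (tent y - tent x)"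
    using fm[of x] fm[of y] by (intro measure_Un_AE AE_I2 fmeasurable.Diff) auto
  also have "\<dots> = measure lborel (tent x) + measure lborel (tent y) - 2 * measure lborel (tent x \<inter> tent y)"
    by (simp add: diff Int_commute)
  finally have eq: "measure lborel (sym_diff (tent x) (tent y)) = d_rank x y / 2"
    using assms unfolding tent_Int m d_rank_def
    by (auto simp: weakly_above_diag_def power2_eq_square field_simps max_def min_def)
  have "sym_diff (tent x) (tent y) \<in> fmeasurable lborel"
    using fm by (intro fmeasurable.Un fmeasurable.Diff)
  then have "emeasure lborel (sym_diff (tent x) (tent y)) = ennreal (d_rank x y / 2)"
    unfolding eq[symmetric] by (intro emeasure_eq_ennreal_measure) (simp add: fmeasurableD2)
  \<comment> \<open>Nonnegativity of \<open>d_rank\<close>, read off from an area, allows the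
    division by 2 to leave \<open>ennreal\<close>.\<close>
  moreover have "0 \<le> d_rank x y"
    using measure_nonneg[of lborel "sym_diff (tent x) (tent y)"] unfolding eq by simp
  ultimately show ?thesis
    by (simp add: divide_ennreal[symmetric])
qed

section \<open>Layer cake estimate and Tonelli in three variables\<close>

text \<open>The levels \<open>a\<close> that separate \<open>r\<close> from \<open>s\<close> lie
  between them, in an interval of length |r - s|. The two additive hypotheses express |r - s| <= e
  without the truncated subtraction of \<open>ennreal\<close>.\<close>

lemma nn_integral_between_levels_le:
  fixes r s e :: ennreal
  assumes "r \<le> s + e" and "s \<le> r + e" and "r \<noteq> \<infinity>" and "s \<noteq> \<infinity>"
  shows "(\<integral>\<^sup>+a. indicator {a. 0 < a \<and> (ennreal a \<le> r) \<noteq> (ennreal a \<le> s)} a \<partial>lborel) \<le> e"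
proof (cases "e = \<infinity>")
  case False
  define r' s' e' where "r' = enn2real r" and "s' = enn2real s" and "e' = enn2real e"
  have nn: "0 \<le> r'" "0 \<le> s'" "0 \<le> e'"
    and eq: "r = ennreal r'" "s = ennreal s'" "e = ennreal e'"
    using assms False by (auto simp: r'_def s'_def e'_def less_top)
  have le: "max r' s' - min r' s' \<le> e'"
    using assms(1,2) nn unfolding eq by (simp flip: ennreal_plus)
  have "(\<integral>\<^sup>+a. indicator {a. 0 < a \<and> (ennreal a \<le> r) \<noteq> (ennreal a \<le> s)} a \<partial>lborel)
      \<le> (\<integral>\<^sup>+a. indicator {min r' s'..max r' s'} a \<partial>lborel)"
    using nn by (intro nn_integral_mono) (auto simp: eq split: split_indicator)
  also have "\<dots> \<le> e"
    using le by (simp add: eq emeasure_lborel_Icc_eq ennreal_leI)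
  finally show ?thesis .
qed simp

text \<open>Three applications of Tonelli: split the pair (a, t) with t outermost, swap a and h for
  fixed t, then merge t and h into p. This puts the level \<open>a\<close> innermost, ready for the
  layer cake estimate.\<close>

lemma nn_integral_lborel_rotate:
  fixes f :: "real \<Rightarrow> real \<times> real \<Rightarrow> ennreal"
  assumes f: "(\<lambda>(a, p). f a p) \<in> borel_measurable (borel \<Otimes>\<^sub>M (borel \<Otimes>\<^sub>M borel))"
  shows "(\<integral>\<^sup>+(a, t). (\<integral>\<^sup>+h. f a (t, h) \<partial>lborel) \<partial>lborel) = (\<integral>\<^sup>+p. (\<integral>\<^sup>+a. f a p \<partial>lborel) \<partial>lborel)"
proof -
  have "(\<lambda>z. f (fst (fst z)) (snd (fst z), snd z)) \<in> borel_measurable ((lborel \<Otimes>\<^sub>M lborel) \<Otimes>\<^sub>M lborel)"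
    using measurable_compose[OF _ f,
        of "\<lambda>z. (fst (fst z), snd (fst z), snd z)" "(lborel \<Otimes>\<^sub>M lborel) \<Otimes>\<^sub>M lborel"] by simp
  then have ath: "(\<lambda>(a, t). \<integral>\<^sup>+h. f a (t, h) \<partial>lborel) \<in> borel_measurable (lborel \<Otimes>\<^sub>M lborel)"
    unfolding case_prod_beta by (intro lborel.borel_measurable_nn_integral) (simp add: case_prod_beta)
  have ah: "(\<lambda>(a, h). f a (t, h)) \<in> borel_measurable (lborel \<Otimes>\<^sub>M lborel)" for t
    using measurable_compose[OF _ f, of "\<lambda>z. (fst z, t, snd z)" "lborel \<Otimes>\<^sub>M lborel"]
    by (simp add: case_prod_beta)
  have "(\<lambda>(p, a). f a p) \<in> borel_measurable ((lborel \<Otimes>\<^sub>M lborel) \<Otimes>\<^sub>M lborel)"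
    using measurable_compose[OF _ f, of "\<lambda>z. (snd z, fst z)" "(lborel \<Otimes>\<^sub>M lborel) \<Otimes>\<^sub>M lborel"]
    by (simp add: case_prod_beta)
  then have pa: "(\<lambda>p. \<integral>\<^sup>+a. f a p \<partial>lborel) \<in> borel_measurable (lborel \<Otimes>\<^sub>M lborel)"
    by (rule lborel.borel_measurable_nn_integral)
  have "(\<integral>\<^sup>+(a, t). (\<integral>\<^sup>+h. f a (t, h) \<partial>lborel) \<partial>lborel) =
      (\<integral>\<^sup>+t. (\<integral>\<^sup>+a. (\<integral>\<^sup>+h. f a (t, h) \<partial>lborel) \<partial>lborel) \<partial>lborel)"
    unfolding lborel_prod[symmetric] using lborel_pair.nn_integral_snd[OF ath] by simp
  also have "\<dots> = (\<integral>\<^sup>+t. (\<integral>\<^sup>+h. (\<integral>\<^sup>+a. f a (t, h) \<partial>lborel) \<partial>lborel) \<partial>lborel)"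
    by (intro nn_integral_cong lborel_pair.Fubini'[symmetric] ah)
  also have "\<dots> = (\<integral>\<^sup>+p. (\<integral>\<^sup>+a. f a p \<partial>lborel) \<partial>lborel)"
    unfolding lborel_prod[symmetric] by (rule lborel.nn_integral_fst[OF pa])
  finally show ?thesis .
qed

section \<open>Couplings: marginals and sigma-finiteness off the diagonal\<close>

text \<open>Provides a countable cover by quadrants, each of finite mass for a tame measure.\<close>

lemma above_diag_in_rational_quadrant:
  assumes "x \<in> above_diag"
  shows "\<exists>t\<in>\<rat>. x \<in> quadrant t 0"
  using assms Rats_dense_in_real[of "fst x" "snd x"]
  by (auto simp: above_diag_def quadrant_def)

text \<open>A coupling need not be \<open>\<sigma>\<close>-finite, since its mass on pairs of diagonal points is arbitrary;
  but such pairs contribute nothing, and away from them tameness makes it so.\<close>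

definition off_diag :: "((real \<times> real) \<times> (real \<times> real)) set" where
  "off_diag = {z \<in> weakly_above_diag \<times> weakly_above_diag. fst z \<in> above_diag \<or> snd z \<in> above_diag}"

context
  fixes \<mu> \<nu> :: "(real \<times> real) measure" and \<gamma> :: "((real \<times> real) \<times> (real \<times> real)) measure"
  assumes coupling: "\<gamma> \<in> couplings \<mu> \<nu>"
begin

lemma sets_coupling: "sets \<gamma> = sets (borel_on (weakly_above_diag \<times> weakly_above_diag))"
  using coupling by (simp add: couplings_def)

lemma space_coupling: "space \<gamma> = weakly_above_diag \<times> weakly_above_diag"
  using sets_eq_imp_space_eq[OF sets_coupling] by (simp add: space_restrict_space)

lemma measurable_fst_coupling [measurable]: "fst \<in> measurable \<gamma> borel"
  unfolding measurable_cong_sets[OF sets_coupling refl]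
  by (intro measurable_restrict_space1 borel_measurable_continuous_onI continuous_intros)

lemma measurable_snd_coupling [measurable]: "snd \<in> measurable \<gamma> borel"
  unfolding measurable_cong_sets[OF sets_coupling refl]
  by (intro measurable_restrict_space1 borel_measurable_continuous_onI continuous_intros)

text \<open>The marginals of a coupling are prescribed only above the diagonal, hence the
  restriction on \<open>A\<close>.\<close>

lemma emeasure_coupling_fst:
  assumes "A \<in> sets borel" and "A \<subseteq> above_diag"
  shows "emeasure \<gamma> {z \<in> space \<gamma>. fst z \<in> A} = emeasure \<mu> A"
proof -
  let ?D = "distr \<gamma> (borel_on weakly_above_diag) fst"
  have A: "A \<in> sets (borel_on weakly_above_diag)"
    using assms above_diag_subset by (auto simp: sets_restrict_space_iff)
  have fst: "fst \<in> measurable \<gamma> (borel_on weakly_above_diag)"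
    by (intro measurable_restrict_space2) (auto simp: space_coupling)
  have "emeasure \<mu> A = emeasure (restrict_space ?D above_diag) A"
    using coupling by (simp add: couplings_def)
  also have "\<dots> = emeasure ?D A"
    using assms above_diag_subset
    by (intro emeasure_restrict_space) (auto simp: space_restrict_space sets_restrict_space_iff Int_absorb2)
  also have "\<dots> = emeasure \<gamma> {z \<in> space \<gamma>. fst z \<in> A}"
    unfolding emeasure_distr[OF fst A] by (rule arg_cong[of _ _ "emeasure \<gamma>"]) auto
  finally show ?thesis ..
qed

lemma emeasure_coupling_snd:
  assumes "A \<in> sets borel" and "A \<subseteq> above_diag"
  shows "emeasure \<gamma> {z \<in> space \<gamma>. snd z \<in> A} = emeasure \<nu> A"
proof -
  let ?D = "distr \<gamma> (borel_on weakly_above_diag) snd"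
  have A: "A \<in> sets (borel_on weakly_above_diag)"
    using assms above_diag_subset by (auto simp: sets_restrict_space_iff)
  have snd: "snd \<in> measurable \<gamma> (borel_on weakly_above_diag)"
    by (intro measurable_restrict_space2) (auto simp: space_coupling)
  have "emeasure \<nu> A = emeasure (restrict_space ?D above_diag) A"
    using coupling by (simp add: couplings_def)
  also have "\<dots> = emeasure ?D A"
    using assms above_diag_subset
    by (intro emeasure_restrict_space) (auto simp: space_restrict_space sets_restrict_space_iff Int_absorb2)
  also have "\<dots> = emeasure \<gamma> {z \<in> space \<gamma>. snd z \<in> A}"
    unfolding emeasure_distr[OF snd A] by (rule arg_cong[of _ _ "emeasure \<gamma>"]) auto
  finally show ?thesis ..
qed

lemma off_diag_sets [measurable]: "off_diag \<in> sets \<gamma>"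
proof -
  have "off_diag = {z \<in> space \<gamma>. fst z \<in> above_diag \<or> snd z \<in> above_diag}"
    by (auto simp: off_diag_def space_coupling)
  also have "\<dots> \<in> sets \<gamma>"
    by measurable
  finally show ?thesis .
qed

text \<open>A pair in \<open>off_diag\<close> has an entry above the diagonal, hence in
  \<open>quadrant t 0\<close> for some rational \<open>t\<close>. The preimages of these quadrants
  under both projections form a countable cover, and their masses are those of the quadrants under
  \<open>\<mu>\<close> or \<open>\<nu>\<close>, finite by tameness.\<close>

lemma sigma_finite_off_diag:
  assumes "q_tame \<mu>" and "q_tame \<nu>"
  shows "sigma_finite_measure (restrict_space \<gamma> off_diag)"
proof
  define C where "C t = {z \<in> space \<gamma>. fst z \<in> quadrant t 0}" for t
  define D where "D t = {z \<in> space \<gamma>. snd z \<in> quadrant t 0}" for t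
  have sub: "z \<in> C t \<Longrightarrow> z \<in> off_diag" "z \<in> D t \<Longrightarrow> z \<in> off_diag" for z t
    using quadrant_subset_above_diag[of 0 t] by (auto simp: C_def D_def off_diag_def space_coupling)
  have sets: "C t \<in> sets \<gamma>" "D t \<in> sets \<gamma>" for t
    unfolding C_def D_def by measurable
  have restr: "emeasure (restrict_space \<gamma> off_diag) A = emeasure \<gamma> A" if "A \<subseteq> off_diag" for A
    using that off_diag_sets by (intro emeasure_restrict_space) (auto simp: sets.Int_space_eq2)
  have "emeasure (restrict_space \<gamma> off_diag) (C t) < \<infinity>" for t
    using assms quadrant_subset_above_diag[of 0 t] sub(1)
    by (subst restr) (auto simp: C_def q_tame_def emeasure_coupling_fst)
  moreover have "emeasure (restrict_space \<gamma> off_diag) (D t) < \<infinity>" for t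
    using assms quadrant_subset_above_diag[of 0 t] sub(2)
    by (subst restr) (auto simp: D_def q_tame_def emeasure_coupling_snd)
  moreover have "off_diag \<subseteq> (\<Union>t\<in>\<rat>. C t) \<union> (\<Union>t\<in>\<rat>. D t)"
    using above_diag_in_rational_quadrant by (fastforce simp: C_def D_def off_diag_def space_coupling)
  moreover have "countable (C ` \<rat> \<union> D ` \<rat>)"
    by (simp add: countable_rat)
  ultimately show "\<exists>A. countable A \<and> A \<subseteq> sets (restrict_space \<gamma> off_diag) \<and>
      \<Union> A = space (restrict_space \<gamma> off_diag) \<and> (\<forall>a\<in>A. emeasure (restrict_space \<gamma> off_diag) a \<noteq> \<infinity>)"
    using sub sets off_diag_sets
    by (intro exI[of _ "C ` \<rat> \<union> D ` \<rat>"])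
       (auto simp: sets_restrict_space_iff space_restrict_space2 less_top sets.Int_space_eq2)
qed

section \<open>The bound for a single coupling\<close>

lemma landscape_dist_le_coupling_cost:
  assumes \<mu>: "q_tame \<mu>" and \<nu>: "q_tame \<nu>"
  shows "L1_norm_on ({0<..} \<times> UNIV) (\<lambda>(a, t). landscape \<mu> a t - landscape \<nu> a t)
    \<le> (\<integral>\<^sup>+(x, y). ennreal (d_rank x y) \<partial>\<gamma>) / 2"
proof -
  define \<Gamma> where "\<Gamma> = restrict_space \<gamma> off_diag"
  interpret sigma_finite_measure \<Gamma>
    unfolding \<Gamma>_def using assms by (rule sigma_finite_off_diag)
  interpret Q: pair_sigma_finite "lborel \<Otimes>\<^sub>M lborel :: (real \<times> real) measure" \<Gamma>
    unfolding lborel_prod ..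
  have space_\<Gamma>: "space \<Gamma> = off_diag"
    by (simp add: \<Gamma>_def space_restrict_space2)
  have [measurable]: "fst \<in> measurable \<gamma> (borel \<Otimes>\<^sub>M borel)" "snd \<in> measurable \<gamma> (borel \<Otimes>\<^sub>M borel)"
    unfolding borel_prod by measurable
  have [measurable]: "fst \<in> measurable \<Gamma> (borel \<Otimes>\<^sub>M borel)" "snd \<in> measurable \<Gamma> (borel \<Otimes>\<^sub>M borel)"
    unfolding \<Gamma>_def borel_prod by (intro measurable_restrict_space1 measurable_fst_coupling measurable_snd_coupling)+
  \<comment> \<open>Joint measurability in p and z, as Tonelli requires; in coordinates, membership
    is a conjunction of strict inequalities.\<close>
  have tent_pred [measurable]: "Measurable.pred ((borel \<Otimes>\<^sub>M borel) \<Otimes>\<^sub>M \<Gamma>) (\<lambda>(p, z). p \<in> tent (f z))"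
    if [measurable]: "f \<in> measurable \<Gamma> (borel \<Otimes>\<^sub>M borel)" for f
  proof -
    have "(\<lambda>(p, z). p \<in> tent (f z)) =
        (\<lambda>(p, z). 0 < snd p \<and> fst (f z) < fst p - snd p \<and> fst p + snd p < snd (f z))"
      by (auto simp: tent_def quadrant_def mem_Times_iff fun_eq_iff)
    then show ?thesis
      by simp
  qed
  \<comment> \<open>\<open>R\<close> and \<open>S\<close> are the two rank functions at p = (t, h),
    set to 0 for h <= 0. Writing them as slice measures of the sigma-finite \<open>\<Gamma>\<close>
    yields their measurability in p. \<open>E p\<close> collects the pairs with exactly one entry in
    the quadrant of p, which bounds the difference of \<open>R\<close> and \<open>S\<close>.\<close>
  define R where "R p = emeasure \<Gamma> {z \<in> space \<Gamma>. p \<in> tent (fst z)}" for p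
  define S where "S p = emeasure \<Gamma> {z \<in> space \<Gamma>. p \<in> tent (snd z)}" for p
  define E where "E p = {z \<in> space \<Gamma>. p \<in> sym_diff (tent (fst z)) (tent (snd z))}" for p
  have [measurable]: "R \<in> borel_measurable (borel \<Otimes>\<^sub>M borel)" "S \<in> borel_measurable (borel \<Otimes>\<^sub>M borel)"
    unfolding R_def S_def by measurable
  \<comment> \<open>For h > 0 a quadrant lies above the diagonal, so replacing
    \<open>\<gamma>\<close> by \<open>\<Gamma>\<close> loses none of its mass.\<close>
  have sub: "{z \<in> space \<gamma>. fst z \<in> quadrant t h} \<subseteq> off_diag"
       "{z \<in> space \<gamma>. snd z \<in> quadrant t h} \<subseteq> off_diag" if "0 < h" for t h
    using that quadrant_subset_above_diag[of h t] by (auto simp: off_diag_def space_coupling)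
  have R_eq: "R (t, h) = (if 0 < h then emeasure \<mu> (quadrant t h) else 0)" for t h
  proof (cases "0 < h")
    case True
    have "{z \<in> space \<Gamma>. (t, h) \<in> tent (fst z)} = {z \<in> space \<gamma>. fst z \<in> quadrant t h}"
      using True sub(1)[OF True] by (auto simp: space_\<Gamma> tent_def off_diag_def space_coupling)
    with True sub(1)[OF True] show ?thesis
      using quadrant_subset_above_diag[of h t] off_diag_sets
      by (simp add: R_def \<Gamma>_def emeasure_restrict_space emeasure_coupling_fst sets.Int_space_eq2)
  qed (simp add: R_def tent_def)
  have S_eq: "S (t, h) = (if 0 < h then emeasure \<nu> (quadrant t h) else 0)" for t h
  proof (cases "0 < h")
    case True
    have "{z \<in> space \<Gamma>. (t, h) \<in> tent (snd z)} = {z \<in> space \<gamma>. snd z \<in> quadrant t h}"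
      using True sub(2)[OF True] by (auto simp: space_\<Gamma> tent_def off_diag_def space_coupling)
    with True sub(2)[OF True] show ?thesis
      using quadrant_subset_above_diag[of h t] off_diag_sets
      by (simp add: S_def \<Gamma>_def emeasure_restrict_space emeasure_coupling_snd sets.Int_space_eq2)
  qed (simp add: S_def tent_def)
  have fin: "R p \<noteq> \<infinity>" "S p \<noteq> \<infinity>" for p
    using \<mu> \<nu> by (cases p; auto simp: R_eq S_eq q_tame_def less_top)+
  have [measurable]: "Measurable.pred \<Gamma> (\<lambda>z. p \<in> tent (f z))"
    if [measurable]: "f \<in> measurable \<Gamma> (borel \<Otimes>\<^sub>M borel)" for f p
    using measurable_compose[OF measurable_Pair1' tent_pred[OF that], of p]
    by (simp add: space_pair_measure)
  have E_sets: "E p \<in> sets \<Gamma>" for p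
    unfolding E_def by simp
  have R_le: "R p \<le> S p + emeasure \<Gamma> (E p)" for p
  proof -
    have "R p \<le> emeasure \<Gamma> ({z \<in> space \<Gamma>. p \<in> tent (snd z)} \<union> E p)"
      unfolding R_def by (intro emeasure_mono sets.Un E_sets) (auto simp: E_def)
    also have "\<dots> \<le> S p + emeasure \<Gamma> (E p)"
      unfolding S_def by (intro emeasure_subadditive E_sets) measurable
    finally show ?thesis .
  qed
  have S_le: "S p \<le> R p + emeasure \<Gamma> (E p)" for p
  proof -
    have "S p \<le> emeasure \<Gamma> ({z \<in> space \<Gamma>. p \<in> tent (fst z)} \<union> E p)"
      unfolding S_def by (intro emeasure_mono sets.Un E_sets) (auto simp: E_def)
    also have "\<dots> \<le> R p + emeasure \<Gamma> (E p)"
      unfolding R_def by (intro emeasure_subadditive E_sets) measurable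
    finally show ?thesis .
  qed
  \<comment> \<open>\<open>?F a p\<close> indicates that the level \<open>a\<close> separates
    \<open>R p\<close> from \<open>S p\<close>: integrated over h it bounds the landscape
    difference, integrated over a it is bounded by the mass of \<open>E p\<close>.\<close>
  let ?F = "\<lambda>a p. indicator {a. 0 < a \<and> (ennreal a \<le> R p) \<noteq> (ennreal a \<le> S p)} a :: ennreal"
  have [measurable]: "(\<lambda>(a, p). ?F a p) \<in> borel_measurable (borel \<Otimes>\<^sub>M (borel \<Otimes>\<^sub>M borel))"
    unfolding indicator_def by measurable
  have diff_le: "ennreal \<bar>landscape \<mu> a t - landscape \<nu> a t\<bar> \<le> (\<integral>\<^sup>+h. ?F a (t, h) \<partial>lborel)"
    if "0 < a" for a t
  proof -
    note landscape_diff_le[OF \<mu> \<nu> that, of t]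
    also have "(\<integral>\<^sup>+h. indicator {h. 0 < h \<and> (ennreal a \<le> emeasure \<mu> (quadrant t h)) \<noteq>
        (ennreal a \<le> emeasure \<nu> (quadrant t h))} h \<partial>lborel) \<le> (\<integral>\<^sup>+h. ?F a (t, h) \<partial>lborel)"
      using that by (intro nn_integral_mono) (auto simp: R_eq S_eq split: split_indicator)
    finally show ?thesis .
  qed
  have "L1_norm_on ({0<..} \<times> UNIV) (\<lambda>(a, t). landscape \<mu> a t - landscape \<nu> a t)
      \<le> (\<integral>\<^sup>+(a, t). (\<integral>\<^sup>+h. ?F a (t, h) \<partial>lborel) \<partial>lborel)"
    unfolding L1_norm_on_def using diff_le
    by (intro nn_integral_mono) (auto split: split_indicator)
  also have "\<dots> = (\<integral>\<^sup>+p. (\<integral>\<^sup>+a. ?F a p \<partial>lborel) \<partial>lborel)"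
    by (rule nn_integral_lborel_rotate) measurable
  also have "\<dots> \<le> (\<integral>\<^sup>+p. emeasure \<Gamma> (E p) \<partial>lborel)"
    by (intro nn_integral_mono nn_integral_between_levels_le R_le S_le fin)
  also have "\<dots> = (\<integral>\<^sup>+p. (\<integral>\<^sup>+z. indicator (sym_diff (tent (fst z)) (tent (snd z))) p \<partial>\<Gamma>) \<partial>lborel)"
  proof (rule nn_integral_cong)
    fix p
    have "emeasure \<Gamma> (E p) = (\<integral>\<^sup>+z. indicator (E p) z \<partial>\<Gamma>)"
      by (simp add: E_sets)
    also have "\<dots> = (\<integral>\<^sup>+z. indicator (sym_diff (tent (fst z)) (tent (snd z))) p \<partial>\<Gamma>)"
      by (intro nn_integral_cong) (auto simp: E_def split: split_indicator)
    finally show "emeasure \<Gamma> (E p) =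
        (\<integral>\<^sup>+z. indicator (sym_diff (tent (fst z)) (tent (snd z))) p \<partial>\<Gamma>)" .
  qed
  \<comment> \<open>Tonelli for Lebesgue measure and \<open>\<Gamma>\<close>: with the pair z fixed,
    the inner integral becomes the area of a symmetric difference of tents.\<close>
  also have "\<dots> = (\<integral>\<^sup>+z. (\<integral>\<^sup>+p. indicator (sym_diff (tent (fst z)) (tent (snd z))) p \<partial>lborel) \<partial>\<Gamma>)"
    unfolding indicator_def lborel_prod[symmetric] by (rule Q.Fubini'[symmetric]) simp
  also have "\<dots> = (\<integral>\<^sup>+z. ennreal (d_rank (fst z) (snd z)) / 2 \<partial>\<Gamma>)"
    by (intro nn_integral_cong) (auto simp: space_\<Gamma> off_diag_def emeasure_tent_sym_diff)
  \<comment> \<open>Restoring the pairs of diagonal points can only enlarge the integral of a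
    nonnegative function.\<close>
  also have "\<dots> \<le> (\<integral>\<^sup>+z. ennreal (d_rank (fst z) (snd z)) / 2 \<partial>\<gamma>)"
    unfolding \<Gamma>_def using off_diag_sets
    by (subst nn_integral_restrict_space)
       (auto simp: sets.Int_space_eq2 intro!: nn_integral_mono split: split_indicator)
  also have "\<dots> = (\<integral>\<^sup>+(x, y). ennreal (d_rank x y) \<partial>\<gamma>) / 2"
    unfolding d_rank_def case_prod_beta by (intro nn_integral_divide) measurable
  finally show ?thesis .
qed

end

theorem theorem5p2:
  fixes \<mu> \<nu> :: "(real \<times> real) measure"
  assumes "countably_supported \<mu>" and "q_tame \<mu>"
    and "countably_supported \<nu>" and "q_tame \<nu>"
    and "W1_rank \<mu> (null_measure (borel_on above_diag)) < \<infinity>"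
    and "W1_rank \<nu> (null_measure (borel_on above_diag)) < \<infinity>"
  shows "L1_norm_on ({0<..} \<times> UNIV) (\<lambda>(a, t). landscape \<mu> a t - landscape \<nu> a t)
           \<le> W1_rank \<mu> \<nu> / 2"
proof -
  let ?L = "L1_norm_on ({0<..} \<times> UNIV) (\<lambda>(a, t). landscape \<mu> a t - landscape \<nu> a t)"
  \<comment> \<open>Moving the factor to the left makes the claim a lower bound for an infimum, so
    division need not be interchanged with \<open>INF\<close>.\<close>
  have "2 * ?L \<le> W1_rank \<mu> \<nu>"
    unfolding W1_rank_def
  proof (rule INF_greatest)
    fix \<gamma> assume "\<gamma> \<in> couplings \<mu> \<nu>"
    then have "2 * ?L \<le> 2 * ((\<integral>\<^sup>+(x, y). ennreal (d_rank x y) \<partial>\<gamma>) / 2)"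
      using assms by (intro mult_left_mono landscape_dist_le_coupling_cost) auto
    then show "2 * ?L \<le> (\<integral>\<^sup>+(x, y). ennreal (d_rank x y) \<partial>\<gamma>)"
      by (simp add: ennreal_times_divide mult.commute[of 2] ennreal_mult_divide_eq)
  qed
  then have "2 * ?L / 2 \<le> W1_rank \<mu> \<nu> / 2"
    by (rule divide_right_mono_ennreal)
  then show ?thesis
    by (simp add: mult.commute[of 2] ennreal_mult_divide_eq)
qed

end
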